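(* Let $S=K[x_1,\dots,x_n]$ be a polynomial ring over a field $K$, let $I\subset S$ be a monomial ideal and let $i\ge 0$ be an integer. Then $$\mathrm{HS}_i(I^{k+1})\subseteq I\cdot \mathrm{HS}_i(I^k)$$ for all $k\gg 0$.
   Context: For $\mathbf a=(a_1,\dots,a_n)\in\mathbb Z_{\ge0}^n$ write $\mathbf x^{\mathbf a}=x_1^{a_1}\cdots x_n^{a_n}$. For a monomial ideal $J\subset S$, the $i$th homological shift ideal of $J$ is the monomial ideal $$\mathrm{HS}_i(J)=(\mathbf x^{\mathbf a}\ :\ \mathrm{Tor}^S_i(K,J)_{\mathbf a}\neq 0),$$ where $\mathrm{Tor}^S_i(K,J)$ carries its natural $\mathbb Z^n$-grading and $K=S/(x_1,\dots,x_n)$. In particular $\mathrm{HS}_0(J)=J$, and $\mathrm{HS}_i(J)=0$ if $i>\mathrm{proj\,dim}(J)$. *)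

theory Defs
  imports Complex_Main "HOL-Library.Poly_Mapping"
begin

text \<open>The polynomial ring \<open>S = K[x_1,\<dots>,x_n]\<close>: the variables are the elements of the finite type
  \<open>'n\<close>, so \<open>n\<close> is its cardinality, and \<open>'n \<Rightarrow>\<^sub>0 nat\<close> is the monoid of exponent vectors.\<close>

type_synonym ('n, 'k) mpoly = "('n \<Rightarrow>\<^sub>0 nat) \<Rightarrow>\<^sub>0 'k"

definition monomial :: "('n \<Rightarrow>\<^sub>0 nat) \<Rightarrow> ('n, 'k::comm_ring_1) mpoly" where
  "monomial a = Poly_Mapping.single a 1"

section \<open>Ideals\<close>

lemma module_times: "module ((*) :: 'a::comm_ring_1 \<Rightarrow> 'a \<Rightarrow> 'a)"
  by unfold_locales (simp_all add: algebra_simps)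

definition ideal_gen :: "'a::comm_ring_1 set \<Rightarrow> 'a set" where
  "ideal_gen B = module.span (*) B"

definition ideal_mult :: "'a::comm_ring_1 set \<Rightarrow> 'a set \<Rightarrow> 'a set" where
  "ideal_mult I J = ideal_gen {f * g | f g. f \<in> I \<and> g \<in> J}"

primrec ideal_pow :: "'a::comm_ring_1 set \<Rightarrow> nat \<Rightarrow> 'a set" where
  "ideal_pow I 0 = UNIV"
| "ideal_pow I (Suc k) = ideal_mult I (ideal_pow I k)"

definition monomial_ideal :: "('n::finite, 'k::field) mpoly set \<Rightarrow> bool" where
  "monomial_ideal I \<longleftrightarrow> (\<exists>A. I = ideal_gen (monomial ` A))"

definition var_ideal :: "('n::finite, 'k::field) mpoly set" where
  "var_ideal = ideal_gen (range (\<lambda>x. monomial (Poly_Mapping.single x 1)))"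

section \<open>Multigraded free resolutions of the residue field\<close>

text \<open>A complex \<open>\<dots> \<rightarrow> F_1 \<rightarrow> F_0\<close> of free \<open>S\<close>-modules of finite rank with an augmentation
  \<open>F_0 \<rightarrow> S/(x_1,\<dots>,x_n)\<close>. The module \<open>F_p\<close> has the basis \<open>e_j\<close> with \<open>j < rk F p\<close>, where \<open>e_j\<close> has
  multidegree \<open>shift F p j\<close>; its elements are the coefficient families \<open>v :: nat \<Rightarrow> S\<close> that vanish at
  all \<open>j \<ge> rk F p\<close>. The entry \<open>mat F p l j\<close> is the coefficient of \<open>e_l\<close> in the image of \<open>e_j\<close> under
  \<open>F_{p+1} \<rightarrow> F_p\<close>, and the augmentation sends \<open>e_j\<close> to the residue class of \<open>aug F j\<close>.

  \<open>S\<close>, the residue field and all monomial ideals are concentrated in multidegrees in \<open>\<nat>^n\<close>, so it is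
  enough to allow basis elements of such multidegrees.\<close>

record (overloaded) ('n, 'k) augmented_complex =
  rk :: "nat \<Rightarrow> nat"
  shift :: "nat \<Rightarrow> nat \<Rightarrow> ('n \<Rightarrow>\<^sub>0 nat)"
  mat :: "nat \<Rightarrow> nat \<Rightarrow> nat \<Rightarrow> ('n, 'k) mpoly"
  aug :: "nat \<Rightarrow> ('n, 'k) mpoly"

text \<open>As \<open>F_p\<close> is free with a fixed basis, \<open>F_p \<otimes> J\<close> is the direct sum of \<open>rk F p\<close> copies of \<open>J\<close>, and
  the induced differential is given by the same matrix. For \<open>J = UNIV\<close> this is \<open>F_p\<close> itself.\<close>

definition tensor ::
  "('n::finite, 'k::field) augmented_complex \<Rightarrow> ('n, 'k) mpoly set \<Rightarrow> nat \<Rightarrow> (nat \<Rightarrow> ('n, 'k) mpoly) set" where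
  "tensor F J p = {v. (\<forall>j < rk F p. v j \<in> J) \<and> (\<forall>j \<ge> rk F p. v j = 0)}"

primrec bd ::
  "('n::finite, 'k::field) augmented_complex \<Rightarrow> nat \<Rightarrow> (nat \<Rightarrow> ('n, 'k) mpoly) \<Rightarrow> (nat \<Rightarrow> ('n, 'k) mpoly)" where
  "bd F 0 v = (\<lambda>_. 0)"
| "bd F (Suc p) v = (\<lambda>l. if l < rk F p then \<Sum>j<rk F (Suc p). mat F p l j * v j else 0)"

definition augmentation ::
  "('n::finite, 'k::field) augmented_complex \<Rightarrow> (nat \<Rightarrow> ('n, 'k) mpoly) \<Rightarrow> ('n, 'k) mpoly" where
  "augmentation F v = (\<Sum>j<rk F 0. v j * aug F j)"

definition cycles ::
  "('n::finite, 'k::field) augmented_complex \<Rightarrow> ('n, 'k) mpoly set \<Rightarrow> nat \<Rightarrow> (nat \<Rightarrow> ('n, 'k) mpoly) set" where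
  "cycles F J p = {v \<in> tensor F J p. bd F p v = (\<lambda>_. 0)}"

definition boundaries ::
  "('n::finite, 'k::field) augmented_complex \<Rightarrow> ('n, 'k) mpoly set \<Rightarrow> nat \<Rightarrow> (nat \<Rightarrow> ('n, 'k) mpoly) set" where
  "boundaries F J p = bd F (Suc p) ` tensor F J (Suc p)"

text \<open>The polynomials \<open>f\<close> for which \<open>f e\<close> is homogeneous of multidegree \<open>a\<close>, where \<open>e\<close> is a basis
  element of multidegree \<open>b\<close>.\<close>

definition homogeneous :: "('n \<Rightarrow>\<^sub>0 nat) \<Rightarrow> ('n \<Rightarrow>\<^sub>0 nat) \<Rightarrow> ('n::finite, 'k::field) mpoly set" where
  "homogeneous b a = {f. \<forall>m \<in> Poly_Mapping.keys f. m + b = a}"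

definition graded_complex :: "('n::finite, 'k::field) augmented_complex \<Rightarrow> bool" where
  "graded_complex F \<longleftrightarrow>
     (\<forall>p. \<forall>l < rk F p. \<forall>j < rk F (Suc p). mat F p l j \<in> homogeneous (shift F p l) (shift F (Suc p) j)) \<and>
     (\<forall>j < rk F 0. aug F j \<in> homogeneous 0 (shift F 0 j))"

definition resolves_residue_field :: "('n::finite, 'k::field) augmented_complex \<Rightarrow> bool" where
  "resolves_residue_field F \<longleftrightarrow>
     graded_complex F \<and>
     (\<forall>f. \<exists>v \<in> tensor F UNIV 0. f - augmentation F v \<in> var_ideal) \<and>
     {v \<in> tensor F UNIV 0. augmentation F v \<in> var_ideal} = boundaries F UNIV 0 \<and>
     (\<forall>p. cycles F UNIV (Suc p) = boundaries F UNIV (Suc p))"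

text \<open>Such resolutions exist (for example the Koszul complex on the variables), and the multigraded
  modules \<open>Tor\<close> do not depend on the choice, up to isomorphism.\<close>

definition residue_field_resolution :: "('n::finite, 'k::field) augmented_complex" where
  "residue_field_resolution = (SOME F. resolves_residue_field F)"

section \<open>Tor and homological shift ideals\<close>

definition homology_rel ::
  "('n::finite, 'k::field) augmented_complex \<Rightarrow> ('n, 'k) mpoly set \<Rightarrow> nat
     \<Rightarrow> ((nat \<Rightarrow> ('n, 'k) mpoly) \<times> (nat \<Rightarrow> ('n, 'k) mpoly)) set" where
  "homology_rel F J p =
     {(u, v). u \<in> cycles F J p \<and> v \<in> cycles F J p \<and> (\<lambda>j. u j - v j) \<in> boundaries F J p}"

definition degree_part ::
  "('n::finite, 'k::field) augmented_complex \<Rightarrow> nat \<Rightarrow> ('n \<Rightarrow>\<^sub>0 nat) \<Rightarrow> (nat \<Rightarrow> ('n, 'k) mpoly) set" where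
  "degree_part F p a = {v. \<forall>j < rk F p. v j \<in> homogeneous (shift F p j) a}"

text \<open>\<open>Tor i J\<close> is the underlying set of \<open>Tor_i(S/(x_1,\<dots>,x_n), J)\<close>, and \<open>Tor_component i J a\<close> is its
  part of multidegree \<open>a\<close>, the set of homology classes of homogeneous cycles of that multidegree.\<close>

definition Tor :: "nat \<Rightarrow> ('n::finite, 'k::field) mpoly set \<Rightarrow> (nat \<Rightarrow> ('n, 'k) mpoly) set set" where
  "Tor i J = cycles residue_field_resolution J i // homology_rel residue_field_resolution J i"

definition Tor_zero :: "nat \<Rightarrow> ('n::finite, 'k::field) mpoly set \<Rightarrow> (nat \<Rightarrow> ('n, 'k) mpoly) set" where
  "Tor_zero i J = homology_rel residue_field_resolution J i `` {\<lambda>_. 0}"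

definition Tor_component ::
  "nat \<Rightarrow> ('n::finite, 'k::field) mpoly set \<Rightarrow> ('n \<Rightarrow>\<^sub>0 nat) \<Rightarrow> (nat \<Rightarrow> ('n, 'k) mpoly) set set" where
  "Tor_component i J a =
     {c \<in> Tor i J. \<exists>z \<in> c. z \<in> degree_part residue_field_resolution i a}"

definition HS :: "nat \<Rightarrow> ('n::finite, 'k::field) mpoly set \<Rightarrow> ('n, 'k) mpoly set" where
  "HS i J = ideal_gen {monomial a | a. Tor_component i J a \<noteq> {Tor_zero i J}}"

end

theory Submission
  imports Defs
begin

text \<open>The homogeneous cycles of all powers of \<open>I\<close> together form a multigraded module over the Rees
  algebra of \<open>I\<close>. Comparing leading basis elements reduces the finite generation of this module to
  Dickson's lemma, so for large \<open>k\<close> every homogeneous cycle over \<open>I^(k+1)\<close> is a combination of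
  products of monomial generators of \<open>I\<close> with homogeneous cycles over \<open>I^k\<close>. If the former is not
  a boundary, then neither is one of the latter. The argument uses nothing about the complex that
  computes \<open>Tor\<close>, except that its modules are free of finite rank and its differentials linear.\<close>

section \<open>Dickson's lemma\<close>

text \<open>Induction on the coordinates. A finite set \<open>T\<close> for the old coordinates
  already handles every element whose new coordinate is at least a bound for \<open>T\<close>; below
  the bound there are finitely many slices, each covered by the induction hypothesis. Labelling
  arbitrary objects by \<open>h\<close>, instead of taking a set of vectors, allows the comparison
  of pairs later on.\<close>

lemma dickson:
  fixes h :: "'s \<Rightarrow> 'a \<Rightarrow> nat"
  assumes "finite X"
  shows "\<exists>T. finite T \<and> T \<subseteq> S \<and> (\<forall>s\<in>S. \<exists>t\<in>T. \<forall>x\<in>X. h t x \<le> h s x)"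
  using assms
proof (induction X arbitrary: S rule: finite_induct)
  case empty
  show ?case
  proof (cases "S = {}")
    case True
    then show ?thesis by (intro exI[of _ "{}"]) simp
  next
    case False
    then obtain s where "s \<in> S" by blast
    then show ?thesis by (intro exI[of _ "{s}"]) simp
  qed
next
  case (insert x X)
  obtain T where T: "finite T" "T \<subseteq> S" "\<forall>s\<in>S. \<exists>t\<in>T. \<forall>y\<in>X. h t y \<le> h s y"
    using insert.IH[of S] by blast
  \<comment> \<open>The extra \<open>0\<close> keeps \<open>Max\<close> meaningful when
    \<open>T\<close> is empty.\<close>
  define N where "N = Max (insert 0 ((\<lambda>t. h t x) ` T))"
  have N: "h t x \<le> N" if "t \<in> T" for t
    unfolding N_def using that T(1) by (intro Max_ge) auto
  let ?S = "\<lambda>v. {s\<in>S. h s x = v}"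
  obtain U where "\<forall>v. finite (U v) \<and> U v \<subseteq> ?S v \<and> (\<forall>s\<in>?S v. \<exists>t\<in>U v. \<forall>y\<in>X. h t y \<le> h s y)"
    by (rule exE[OF choice[OF allI[OF insert.IH]]])
  then have U: "finite (U v)" "U v \<subseteq> ?S v" "\<forall>s\<in>?S v. \<exists>t\<in>U v. \<forall>y\<in>X. h t y \<le> h s y" for v
    by simp_all
  let ?T = "T \<union> (\<Union>v<N. U v)"
  have "\<exists>t\<in>?T. \<forall>y\<in>insert x X. h t y \<le> h s y" if s: "s \<in> S" for s
  proof (cases "h s x < N")
    case True
    obtain t where t: "t \<in> U (h s x)" "\<forall>y\<in>X. h t y \<le> h s y"
      using U(3) s by blast
    moreover have "h t x = h s x" using U(2) t(1) by blast
    ultimately show ?thesis using True by (intro bexI[of _ t]) auto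
  next
    case False
    obtain t where "t \<in> T" "\<forall>y\<in>X. h t y \<le> h s y" using T(3) s by blast
    then show ?thesis using N[of t] False by (intro bexI[of _ t]) auto
  qed
  moreover have "finite ?T" using T(1) U(1) by simp
  moreover have "?T \<subseteq> S" using T(2) U(2) by blast
  ultimately show ?case by blast
qed

lemma poly_mapping_le_add_diff:
  fixes u a :: "'n \<Rightarrow>\<^sub>0 nat"
  assumes "\<And>x. Poly_Mapping.lookup u x \<le> Poly_Mapping.lookup a x"
  shows "u + (a - u) = a"
  by (rule poly_mapping_eqI) (simp add: lookup_add lookup_minus assms)

section \<open>Ideals and powers of monomial ideals\<close>

definition is_ideal :: "'a::comm_ring_1 set \<Rightarrow> bool" where
  "is_ideal J \<longleftrightarrow> 0 \<in> J \<and> (\<forall>f\<in>J. \<forall>g\<in>J. f + g \<in> J) \<and> (\<forall>r. \<forall>f\<in>J. r * f \<in> J)"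

lemma is_idealD:
  assumes "is_ideal J"
  shows "0 \<in> J" "f \<in> J \<Longrightarrow> g \<in> J \<Longrightarrow> f + g \<in> J" "f \<in> J \<Longrightarrow> r * f \<in> J"
  using assms unfolding is_ideal_def by blast+

lemma is_ideal_diff:
  assumes "is_ideal J" "f \<in> J" "g \<in> J"
  shows "f - g \<in> J"
  using is_idealD(2)[OF assms(1,2) is_idealD(3)[OF assms(1,3), of "-1"]] by simp

lemma is_ideal_ideal_gen: "is_ideal (ideal_gen B)"
  unfolding is_ideal_def ideal_gen_def
  by (auto intro: module.span_zero[OF module_times] module.span_add[OF module_times]
      module.span_scale[OF module_times])

lemma ideal_gen_base: "b \<in> B \<Longrightarrow> b \<in> ideal_gen B"
  unfolding ideal_gen_def by (rule module.span_base[OF module_times])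

lemma ideal_gen_minimal: "B \<subseteq> J \<Longrightarrow> is_ideal J \<Longrightarrow> ideal_gen B \<subseteq> J"
  unfolding ideal_gen_def
  by (rule module.span_minimal[OF module_times])
    (auto simp: module.subspace_def[OF module_times] is_ideal_def)

lemma is_ideal_ideal_mult: "is_ideal (ideal_mult I J)"
  unfolding ideal_mult_def by (rule is_ideal_ideal_gen)

lemma ideal_mult_base: "f \<in> I \<Longrightarrow> g \<in> J \<Longrightarrow> f * g \<in> ideal_mult I J"
  unfolding ideal_mult_def by (rule ideal_gen_base) blast

lemma is_ideal_ideal_pow: "is_ideal (ideal_pow I k)"
  by (cases k) (simp_all add: is_ideal_ideal_mult, simp add: is_ideal_def)

lemma monomial_add: "monomial (a + b) = (monomial a * monomial b :: ('n, 'k::comm_ring_1) mpoly)"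
  by (simp add: monomial_def mult_single)

text \<open>Supports of sums lie in unions of supports, those of products in sums of supports. With
  \<open>ideal_gen_minimal\<close> this extends a support bound from generators to the whole
  ideal.\<close>

lemma is_ideal_keys:
  fixes E :: "('n \<Rightarrow>\<^sub>0 nat) set"
  assumes "\<And>m d. m \<in> E \<Longrightarrow> d + m \<in> E"
  shows "is_ideal {f :: ('n, 'k::comm_ring_1) mpoly. Poly_Mapping.keys f \<subseteq> E}"
  unfolding is_ideal_def
proof (intro conjI ballI allI; clarsimp)
  fix f g :: "('n, 'k) mpoly" and x
  assume "Poly_Mapping.keys f \<subseteq> E" "Poly_Mapping.keys g \<subseteq> E" "x \<in> Poly_Mapping.keys (f + g)"
  then show "x \<in> E" using keys_add[of f g] by blast
next
  fix r f :: "('n, 'k) mpoly" and x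
  assume "Poly_Mapping.keys f \<subseteq> E" "x \<in> Poly_Mapping.keys (r * f)"
  then show "x \<in> E" using keys_mult[of r f] assms by blast
qed

text \<open>The exponents of the multiples of products of \<open>k\<close> monomials with exponents in \<open>A\<close>;
  \<open>g u\<close> is the multiplicity of the factor \<open>u\<close>.\<close>

definition pow_exps :: "('n \<Rightarrow>\<^sub>0 nat) set \<Rightarrow> nat \<Rightarrow> ('n \<Rightarrow>\<^sub>0 nat) set" where
  "pow_exps A k = {m. \<exists>g. sum g A = k \<and> (\<forall>x. (\<Sum>u\<in>A. g u * Poly_Mapping.lookup u x) \<le> Poly_Mapping.lookup m x)}"

lemma pow_exps_upward: "m \<in> pow_exps A k \<Longrightarrow> d + m \<in> pow_exps A k"
  unfolding pow_exps_def by (auto simp: lookup_add intro: trans_le_add2)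

text \<open>Effect of one more copy of the factor \<open>u\<close>: constant weights
  \<open>1\<close> track the number of factors, weights \<open>lookup v x\<close> the exponent of
  the variable \<open>x\<close>.\<close>

lemma sum_increment:
  fixes g :: "'a \<Rightarrow> nat" and c :: "'a \<Rightarrow> nat"
  assumes "finite A" "u \<in> A"
  shows "(\<Sum>v\<in>A. (g(u := Suc (g u))) v * c v) = c u + (\<Sum>v\<in>A. g v * c v)"
  using assms by (subst (1 2) sum.remove[of A u]) (auto intro!: sum.cong)

lemma pow_exps_Suc:
  assumes "finite A" "u \<in> A" "m \<in> pow_exps A k"
  shows "u + m \<in> pow_exps A (Suc k)"
proof -
  obtain g where g: "sum g A = k" "\<And>x. (\<Sum>v\<in>A. g v * Poly_Mapping.lookup v x) \<le> Poly_Mapping.lookup m x"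
    using assms(3) by (auto simp: pow_exps_def)
  let ?g = "g(u := Suc (g u))"
  have "sum ?g A = Suc k"
    using sum_increment[OF assms(1,2), of g "\<lambda>_. 1"] g(1) by simp
  moreover have "(\<Sum>v\<in>A. ?g v * Poly_Mapping.lookup v x) \<le> Poly_Mapping.lookup (u + m) x" for x
    using sum_increment[OF assms(1,2), of g "\<lambda>v. Poly_Mapping.lookup v x"] g(2)[of x]
    by (simp add: lookup_add)
  ultimately show ?thesis unfolding pow_exps_def by blast
qed

text \<open>As the number of factors is positive, some multiplicity is positive, and one copy of
  that factor can be split off.\<close>

lemma pow_exps_SucE:
  assumes "finite A" "m \<in> pow_exps A (Suc k)"
  obtains u m' where "u \<in> A" "m = u + m'" "m' \<in> pow_exps A k"
proof -
  obtain g where g: "sum g A = Suc k" "\<And>x. (\<Sum>v\<in>A. g v * Poly_Mapping.lookup v x) \<le> Poly_Mapping.lookup m x"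
    using assms(2) by (auto simp: pow_exps_def)
  obtain u where u: "u \<in> A" "g u > 0"
    using g(1) by (metis Zero_not_Suc gr0I sum.neutral)
  define g' where "g' = g(u := g u - 1)"
  have gg': "g = g'(u := Suc (g' u))" using u(2) by (auto simp: g'_def)
  have le: "Poly_Mapping.lookup u x + (\<Sum>v\<in>A. g' v * Poly_Mapping.lookup v x) \<le> Poly_Mapping.lookup m x" for x
    using sum_increment[OF assms(1) u(1), of g' "\<lambda>v. Poly_Mapping.lookup v x"] g(2)[of x] gg' by simp
  have "sum g' A = k"
    using sum_increment[OF assms(1) u(1), of g' "\<lambda>_. 1"] g(1) gg' by simp
  moreover have "(\<Sum>v\<in>A. g' v * Poly_Mapping.lookup v x) \<le> Poly_Mapping.lookup (m - u) x" for x
    using le[of x] by (simp add: lookup_minus)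
  ultimately have "m - u \<in> pow_exps A k" unfolding pow_exps_def by blast
  moreover have "m = u + (m - u)"
    using le by (intro poly_mapping_le_add_diff[symmetric]) (meson add_leE)
  ultimately show thesis using that u(1) by blast
qed

text \<open>What the argument uses about a monomial ideal: finitely many monomials in it, one of
  which divides any given monomial occurring in an element.\<close>

locale finitely_generated_exps =
  fixes I :: "('n::finite, 'k::field) mpoly set" and A :: "('n \<Rightarrow>\<^sub>0 nat) set"
  assumes fin: "finite A"
    and monomial_mem: "\<And>u. u \<in> A \<Longrightarrow> monomial u \<in> I"
    and keys_dominated: "\<And>f m. f \<in> I \<Longrightarrow> m \<in> Poly_Mapping.keys f \<Longrightarrow> \<exists>u\<in>A. \<exists>d. m = d + u"
begin

lemma keys_ideal_pow: "f \<in> ideal_pow I k \<Longrightarrow> Poly_Mapping.keys f \<subseteq> pow_exps A k"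
proof (induction k arbitrary: f)
  case 0
  have "m \<in> pow_exps A 0" for m
    unfolding pow_exps_def by (auto intro: exI[of _ "\<lambda>_. 0"])
  then show ?case by blast
next
  case (Suc k)
  let ?E = "{f :: ('n, 'k) mpoly. Poly_Mapping.keys f \<subseteq> pow_exps A (Suc k)}"
  have "{f * g |f g. f \<in> I \<and> g \<in> ideal_pow I k} \<subseteq> ?E"
  proof clarsimp
    fix f g x
    assume f: "f \<in> I" and g: "g \<in> ideal_pow I k" and x: "x \<in> Poly_Mapping.keys (f * g)"
    obtain a b where ab: "x = a + b" "a \<in> Poly_Mapping.keys f" "b \<in> Poly_Mapping.keys g"
      using x keys_mult[of f g] by blast
    obtain u d where "u \<in> A" "a = d + u" using keys_dominated f ab(2) by blast
    moreover have "b \<in> pow_exps A k" using Suc.IH[OF g] ab(3) by blast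
    ultimately show "x \<in> pow_exps A (Suc k)"
      using pow_exps_upward[OF pow_exps_Suc[OF fin], of u b k d] ab(1) by (simp add: add.assoc)
  qed
  then have "ideal_mult I (ideal_pow I k) \<subseteq> ?E"
    unfolding ideal_mult_def by (rule ideal_gen_minimal) (intro is_ideal_keys pow_exps_upward)
  then show ?case using Suc.prems by auto
qed

text \<open>The generators dividing \<open>e\<close> are multiplied on one at a time, each raising
  the power by one; the ideal absorbs the remaining cofactor.\<close>

lemma monomial_times_ideal_pow:
  "e \<in> pow_exps A q \<Longrightarrow> f \<in> ideal_pow I k \<Longrightarrow> monomial e * f \<in> ideal_pow I (k + q)"
proof (induction q arbitrary: e)
  case 0
  then show ?case using is_idealD(3)[OF is_ideal_ideal_pow] by simp
next
  case (Suc q)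
  obtain u e' where u: "u \<in> A" "e = u + e'" "e' \<in> pow_exps A q"
    using pow_exps_SucE[OF fin Suc.prems(1)] .
  have "monomial u * (monomial e' * f) \<in> ideal_pow I (Suc (k + q))"
    using ideal_mult_base[OF monomial_mem[OF u(1)] Suc.IH[OF u(3) Suc.prems(2)]] by simp
  then show ?case by (simp add: u(2) monomial_add mult.assoc)
qed

end

text \<open>Dickson's lemma selects finitely many of the given generators such that each generator
  is a multiple of a selected one; this divisibility passes to all supports.\<close>

lemma monomial_ideal_finitely_generated:
  fixes I :: "('n::finite, 'k::field) mpoly set"
  assumes "monomial_ideal I"
  shows "\<exists>A. finitely_generated_exps I A"
proof -
  obtain B where B: "I = ideal_gen (monomial ` B)" using assms by (auto simp: monomial_ideal_def)
  obtain A where A: "finite A" "A \<subseteq> B" "\<forall>b\<in>B. \<exists>u\<in>A. \<forall>x\<in>UNIV. Poly_Mapping.lookup u x \<le> Poly_Mapping.lookup b x"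
    using dickson[of "UNIV :: 'n set" B Poly_Mapping.lookup] by auto
  let ?E = "{m. \<exists>u\<in>A. \<exists>d. m = d + u}"
  have "is_ideal {f :: ('n, 'k) mpoly. Poly_Mapping.keys f \<subseteq> ?E}"
  proof (rule is_ideal_keys)
    fix m d assume "m \<in> ?E"
    then obtain u c where "u \<in> A" "m = c + u" by blast
    then show "d + m \<in> ?E" by (intro CollectI bexI[of _ u] exI[of _ "d + c"]) (simp_all add: add.assoc)
  qed
  moreover have "monomial ` B \<subseteq> {f :: ('n, 'k) mpoly. Poly_Mapping.keys f \<subseteq> ?E}"
  proof
    fix f :: "('n, 'k) mpoly" assume "f \<in> monomial ` B"
    then obtain b where b: "b \<in> B" "f = monomial b" by blast
    obtain u where "u \<in> A" "\<forall>x. Poly_Mapping.lookup u x \<le> Poly_Mapping.lookup b x"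
      using A(3) b(1) by blast
    then have "b \<in> ?E"
      using poly_mapping_le_add_diff[of u b]
      by (intro CollectI bexI[of _ u] exI[of _ "b - u"]) (simp_all add: add.commute)
    then show "f \<in> {f. Poly_Mapping.keys f \<subseteq> ?E}" by (simp add: b(2) monomial_def)
  qed
  ultimately have "I \<subseteq> {f. Poly_Mapping.keys f \<subseteq> ?E}"
    unfolding B by (intro ideal_gen_minimal)
  then have "finitely_generated_exps I A"
    using A(1,2) by unfold_locales (auto simp: B intro!: ideal_gen_base)
  then show ?thesis by blast
qed

section \<open>Homogeneous cycles\<close>

lemma bd_diff: "bd F p (\<lambda>j. v j - w j) = (\<lambda>l. bd F p v l - bd F p w l)"
proof (cases p)
  case (Suc q)
  then show ?thesis by (auto simp: right_diff_distrib sum_subtractf)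
qed simp

lemma bd_scale: "bd F p (\<lambda>j. r * v j) = (\<lambda>l. r * bd F p v l)"
proof (cases p)
  case (Suc q)
  then show ?thesis by (simp add: fun_eq_iff sum_distrib_left mult.left_commute)
qed simp

lemma tensor_diff:
  assumes "is_ideal J" "v \<in> tensor F J p" "w \<in> tensor F J p"
  shows "(\<lambda>j. v j - w j) \<in> tensor F J p"
  using assms by (auto simp: tensor_def is_ideal_diff)

text \<open>Two ideals are allowed so that a monomial of \<open>I\<close> can carry elements over
  one power of \<open>I\<close> to the next.\<close>

lemma tensor_scale:
  assumes "\<And>f. f \<in> J \<Longrightarrow> r * f \<in> J'" "v \<in> tensor F J p"
  shows "(\<lambda>j. r * v j) \<in> tensor F J' p"
  using assms by (auto simp: tensor_def)

lemma cycles_diff: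
  assumes "is_ideal J" "v \<in> cycles F J p" "w \<in> cycles F J p"
  shows "(\<lambda>j. v j - w j) \<in> cycles F J p"
  using assms by (auto simp: cycles_def tensor_diff bd_diff)

lemma cycles_scale:
  assumes "\<And>f. f \<in> J \<Longrightarrow> r * f \<in> J'" "v \<in> cycles F J p"
  shows "(\<lambda>j. r * v j) \<in> cycles F J' p"
  using assms by (auto simp: cycles_def bd_scale intro: tensor_scale)

lemma boundaries_diff:
  assumes "is_ideal J" "v \<in> boundaries F J p" "w \<in> boundaries F J p"
  shows "(\<lambda>j. v j - w j) \<in> boundaries F J p"
proof -
  obtain v' w' where "v' \<in> tensor F J (Suc p)" "v = bd F (Suc p) v'"
      "w' \<in> tensor F J (Suc p)" "w = bd F (Suc p) w'"
    using assms by (auto simp: boundaries_def simp del: bd.simps)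
  then show ?thesis unfolding boundaries_def
    by (intro image_eqI[of _ _ "\<lambda>j. v' j - w' j"] tensor_diff assms) (simp_all only: bd_diff)
qed

lemma boundaries_scale:
  assumes "\<And>f. f \<in> J \<Longrightarrow> r * f \<in> J'" "v \<in> boundaries F J p"
  shows "(\<lambda>j. r * v j) \<in> boundaries F J' p"
proof -
  obtain v' where "v' \<in> tensor F J (Suc p)" "v = bd F (Suc p) v'"
    using assms by (auto simp: boundaries_def simp del: bd.simps)
  then show ?thesis unfolding boundaries_def
    by (intro image_eqI[of _ _ "\<lambda>j. r * v' j"] tensor_scale[OF assms(1)]) (simp_all only: bd_scale)
qed

lemma zero_cycles: "is_ideal J \<Longrightarrow> (\<lambda>_. 0) \<in> cycles F J p"
  using is_idealD(1) by (cases p) (auto simp: cycles_def tensor_def)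

lemma zero_boundaries:
  assumes "is_ideal J"
  shows "(\<lambda>_. 0) \<in> boundaries F J p"
  unfolding boundaries_def
  using is_idealD(1)[OF assms] by (intro image_eqI[of _ _ "\<lambda>_. 0"]) (auto simp: tensor_def)

section \<open>Homology classes and multigraded components of Tor\<close>

lemma equiv_homology_rel:
  assumes "is_ideal J"
  shows "equiv (cycles F J p) (homology_rel F J p)"
proof (rule equivI)
  show "homology_rel F J p \<subseteq> cycles F J p \<times> cycles F J p"
    by (auto simp: homology_rel_def)
  show "refl_on (cycles F J p) (homology_rel F J p)"
    using zero_boundaries[OF assms] by (auto simp: refl_on_def homology_rel_def)
  show "sym (homology_rel F J p)"
  proof (rule symI)
    fix u v assume "(u, v) \<in> homology_rel F J p"
    then show "(v, u) \<in> homology_rel F J p"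
      using boundaries_diff[OF assms zero_boundaries[OF assms]]
      by (fastforce simp: homology_rel_def)
  qed
  show "trans (homology_rel F J p)"
  proof (rule transI)
    fix u v w assume uv: "(u, v) \<in> homology_rel F J p" and vw: "(v, w) \<in> homology_rel F J p"
    \<comment> \<open>Boundaries are known to be closed under differences, hence the detour
      \<open>u - w = (u - v) - (w - v)\<close>.\<close>
    have "(\<lambda>j. w j - v j) \<in> boundaries F J p"
      using vw boundaries_diff[OF assms zero_boundaries[OF assms]]
      by (fastforce simp: homology_rel_def)
    then show "(u, w) \<in> homology_rel F J p"
      using uv vw boundaries_diff[OF assms, of "\<lambda>j. u j - v j" F p "\<lambda>j. w j - v j"]
      by (auto simp: homology_rel_def)
  qed
qed

definition hom_cycles ::
  "('n::finite, 'k::field) augmented_complex \<Rightarrow> ('n, 'k) mpoly set \<Rightarrow> nat \<Rightarrow> ('n \<Rightarrow>\<^sub>0 nat)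
     \<Rightarrow> (nat \<Rightarrow> ('n, 'k) mpoly) set" where
  "hom_cycles F J p a = cycles F J p \<inter> degree_part F p a"

text \<open>A cycle has zero class exactly when it is a boundary, and the component consists of the
  classes of homogeneous cycles of degree \<open>a\<close>.\<close>

lemma Tor_component_nonzero_iff:
  fixes J :: "('n::finite, 'k::field) mpoly set"
  assumes J: "is_ideal J"
  shows "Tor_component i J a \<noteq> {Tor_zero i J} \<longleftrightarrow>
    \<not> hom_cycles residue_field_resolution J i a \<subseteq> boundaries residue_field_resolution J i"
proof -
  let ?F = "residue_field_resolution :: ('n, 'k) augmented_complex"
  let ?R = "homology_rel ?F J i"
  note eq = equiv_homology_rel[OF J, of ?F i]
  have class_zero: "?R `` {z} = Tor_zero i J \<longleftrightarrow> z \<in> boundaries ?F J i" if "z \<in> cycles ?F J i" for z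
    using eq_equiv_class_iff[OF eq that zero_cycles[OF J]] that zero_cycles[OF J, of ?F i]
    by (simp add: Tor_zero_def homology_rel_def)
  have img: "Tor_component i J a = (\<lambda>z. ?R `` {z}) ` hom_cycles ?F J i a"
  proof (intro equalityI subsetI)
    fix c assume "c \<in> Tor_component i J a"
    then obtain z y where zy: "c = ?R `` {y}" "z \<in> c" "z \<in> degree_part ?F i a"
      by (auto simp: Tor_component_def Tor_def quotient_def)
    \<comment> \<open>The representative \<open>y\<close> need not be homogeneous; it is exchanged
      for the homogeneous member \<open>z\<close> of its class.\<close>
    then have "(y, z) \<in> ?R" by simp
    then show "c \<in> (\<lambda>z. ?R `` {z}) ` hom_cycles ?F J i a"
      using zy equiv_class_eq[OF eq, of y z]
      by (intro image_eqI[of _ _ z]) (auto simp: hom_cycles_def homology_rel_def)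
  next
    fix c assume "c \<in> (\<lambda>z. ?R `` {z}) ` hom_cycles ?F J i a"
    then show "c \<in> Tor_component i J a"
      using equiv_class_self[OF eq]
      by (auto simp: Tor_component_def Tor_def hom_cycles_def intro: quotientI)
  qed
  \<comment> \<open>The zero cycle is homogeneous of every degree, so the component contains the
    zero class and equality with the singleton reduces to an inclusion.\<close>
  have "(\<lambda>_. 0) \<in> hom_cycles ?F J i a"
    using zero_cycles[OF J] by (auto simp: hom_cycles_def degree_part_def homogeneous_def)
  then have "Tor_zero i J \<in> Tor_component i J a"
    unfolding img Tor_zero_def by (rule image_eqI[OF refl])
  then have "Tor_component i J a = {Tor_zero i J} \<longleftrightarrow> Tor_component i J a \<subseteq> {Tor_zero i J}"
    by (metis subset_refl subset_singletonD empty_iff)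
  also have "\<dots> \<longleftrightarrow> (\<forall>z\<in>hom_cycles ?F J i a. ?R `` {z} = Tor_zero i J)"
    unfolding img image_subset_iff singleton_iff ..
  also have "\<dots> \<longleftrightarrow> hom_cycles ?F J i a \<subseteq> boundaries ?F J i"
    using class_zero by (auto simp: hom_cycles_def)
  finally show ?thesis by simp
qed

section \<open>Homogeneous coefficients and operations on homogeneous cycles\<close>

lemma homogeneous_diff:
  "f \<in> homogeneous b a \<Longrightarrow> g \<in> homogeneous b a \<Longrightarrow> f - g \<in> homogeneous b a"
  using keys_diff[of f g] by (auto simp: homogeneous_def)

lemma homogeneous_monomial_times:
  fixes f :: "('n::finite, 'k::field) mpoly"
  assumes "f \<in> homogeneous b a"
  shows "monomial e * f \<in> homogeneous b (e + a)"
proof -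
  have "m + b = e + a" if m: "m \<in> Poly_Mapping.keys (monomial e * f)" for m
  proof -
    obtain m' where "m = e + m'" "m' \<in> Poly_Mapping.keys f"
      using m keys_mult[of "monomial e" f] by (auto simp: monomial_def)
    then show ?thesis using assms by (auto simp: homogeneous_def add.assoc)
  qed
  then show ?thesis by (simp add: homogeneous_def)
qed

lemma homogeneous_scalar_times:
  fixes f :: "('n::finite, 'k::field) mpoly"
  assumes "f \<in> homogeneous b a"
  shows "Poly_Mapping.single 0 c * f \<in> homogeneous b a"
  using assms keys_mult[of "Poly_Mapping.single 0 c" f]
  by (fastforce simp: homogeneous_def split: if_splits)

text \<open>Only one exponent \<open>m\<close> can satisfy \<open>m + b = a\<close>, so both
  polynomials are scalar multiples of one monomial, and the scalars lie in a field. This makes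
  leading terms of equal degree cancellable.\<close>

lemma homogeneous_proportional:
  fixes f g :: "('n::finite, 'k::field) mpoly"
  assumes "f \<in> homogeneous b a" "g \<in> homogeneous b a" "g \<noteq> 0"
  shows "\<exists>c. f = Poly_Mapping.single 0 c * g"
proof -
  obtain m where m: "m \<in> Poly_Mapping.keys g" using assms(3) by (metis all_not_in_conv keys_eq_empty)
  have uniq: "m' = m" if "m' \<in> Poly_Mapping.keys f \<or> m' \<in> Poly_Mapping.keys g" for m'
    using that assms(1,2) m by (auto simp: homogeneous_def) (metis add_right_imp_eq)+
  have single: "h = Poly_Mapping.single m (Poly_Mapping.lookup h m)" if "Poly_Mapping.keys h \<subseteq> {m}" for h :: "('n, 'k) mpoly"
    using that by (intro poly_mapping_eqI) (auto simp: lookup_single when_def in_keys_iff)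
  have f: "f = Poly_Mapping.single m (Poly_Mapping.lookup f m)" and g: "g = Poly_Mapping.single m (Poly_Mapping.lookup g m)"
    using uniq by (auto intro!: single)
  have "Poly_Mapping.lookup g m \<noteq> 0" using m by (simp add: in_keys_iff)
  then have "Poly_Mapping.single 0 (Poly_Mapping.lookup f m / Poly_Mapping.lookup g m) * Poly_Mapping.single m (Poly_Mapping.lookup g m)
      = Poly_Mapping.single m (Poly_Mapping.lookup f m)"
    by (simp add: mult_single)
  then show ?thesis using f g by metis
qed

text \<open>Multiplication by a monomial only shifts coefficients; hence it preserves the position
  of a leading entry.\<close>

lemma monomial_times_eq_0_iff:
  fixes f :: "('n::finite, 'k::field) mpoly"
  shows "monomial e * f = 0 \<longleftrightarrow> f = 0"
proof
  assume *: "monomial e * f = 0"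
  have "Poly_Mapping.lookup (monomial e * f) (e + m) = Poly_Mapping.lookup f m" for m
    by (simp add: monomial_def lookup_mult lookup_single when_mult)
  then show "f = 0" using * by (intro poly_mapping_eqI) (metis lookup_zero)
qed simp

lemma hom_cycles_diff:
  assumes "is_ideal J" "v \<in> hom_cycles F J p a" "w \<in> hom_cycles F J p a"
  shows "(\<lambda>j. v j - w j) \<in> hom_cycles F J p a"
  using assms by (auto simp: hom_cycles_def degree_part_def cycles_diff homogeneous_diff)

lemma hom_cycles_scalar:
  assumes "is_ideal J" "v \<in> hom_cycles F J p a"
  shows "(\<lambda>j. Poly_Mapping.single 0 c * v j) \<in> hom_cycles F J p a"
  using assms cycles_scale[OF is_idealD(3)[OF assms(1)]]
  by (auto simp: hom_cycles_def degree_part_def homogeneous_scalar_times)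

lemma hom_cycles_monomial:
  assumes "\<And>f. f \<in> J \<Longrightarrow> monomial e * f \<in> J'" "v \<in> hom_cycles F J p a"
  shows "(\<lambda>j. monomial e * v j) \<in> hom_cycles F J' p (e + a)"
  using assms(2) cycles_scale[OF assms(1)]
  by (auto simp: hom_cycles_def degree_part_def homogeneous_monomial_times)

section \<open>Leading degrees of homogeneous cycles\<close>

text \<open>The leading entry is the nonzero one of largest index. Being homogeneous, it is
  determined up to a scalar by its index and the degree of the cycle.\<close>

definition lead_degrees ::
  "('n::finite, 'k::field) augmented_complex \<Rightarrow> ('n, 'k) mpoly set \<Rightarrow> nat \<Rightarrow> nat \<Rightarrow> ('n \<Rightarrow>\<^sub>0 nat) set" where
  "lead_degrees F J p j = {a. \<exists>v\<in>hom_cycles F J p a. v j \<noteq> 0 \<and> (\<forall>l>j. v l = 0)}"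

context finitely_generated_exps
begin

text \<open>Stability under the Rees algebra: a monomial of the \<open>q\<close>th power moves a
  cycle \<open>q\<close> powers up and keeps its leading index.\<close>

lemma lead_degrees_add:
  assumes "a \<in> lead_degrees F (ideal_pow I k) p j" "e \<in> pow_exps A q"
  shows "e + a \<in> lead_degrees F (ideal_pow I (k + q)) p j"
proof -
  obtain v where v: "v \<in> hom_cycles F (ideal_pow I k) p a" "v j \<noteq> 0" "\<forall>l>j. v l = 0"
    using assms(1) by (auto simp: lead_degrees_def)
  have "(\<lambda>j. monomial e * v j) \<in> hom_cycles F (ideal_pow I (k + q)) p (e + a)"
    by (rule hom_cycles_monomial[OF monomial_times_ideal_pow[OF assms(2)] v(1)])
  then show ?thesis using v(2,3) unfolding lead_degrees_def
    by (auto simp: monomial_times_eq_0_iff intro!: bexI[of _ "\<lambda>j. monomial e * v j"])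
qed

lemma lead_degreesE:
  assumes "a \<in> lead_degrees F (ideal_pow I k) p j" "j < rk F p"
  obtains g where "sum g A = k"
    "\<And>x. Poly_Mapping.lookup (shift F p j) x + (\<Sum>u\<in>A. g u * Poly_Mapping.lookup u x) \<le> Poly_Mapping.lookup a x"
proof -
  obtain v where v: "v \<in> hom_cycles F (ideal_pow I k) p a" "v j \<noteq> 0"
    using assms(1) by (auto simp: lead_degrees_def)
  obtain m where m: "m \<in> Poly_Mapping.keys (v j)" using v(2) by (metis all_not_in_conv keys_eq_empty)
  have "v j \<in> ideal_pow I k" "v j \<in> homogeneous (shift F p j) a"
    using v(1) assms(2) by (auto simp: hom_cycles_def cycles_def tensor_def degree_part_def)
  then have "m \<in> pow_exps A k" "a = m + shift F p j"
    using m keys_ideal_pow by (auto simp: homogeneous_def)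
  then show thesis using that by (auto simp: pow_exps_def lookup_add)
qed

text \<open>Finite generation over the Rees algebra. Each leading degree is paired with
  multiplicities \<open>g\<close> of generators dividing the leading monomial, and Dickson's lemma
  yields finitely many pairs below all others. Above their powers, at least one generator splits
  off.\<close>

lemma lead_degrees_eventually:
  assumes j: "j < rk F p"
  shows "\<forall>\<^sub>F k in sequentially. \<forall>a \<in> lead_degrees F (ideal_pow I (Suc k)) p j.
    \<exists>u\<in>A. \<exists>b \<in> lead_degrees F (ideal_pow I k) p j. a = u + b"
proof -
  let ?L = "\<lambda>k. lead_degrees F (ideal_pow I k) p j"
  let ?c = "\<lambda>g x. Poly_Mapping.lookup (shift F p j) x + (\<Sum>u\<in>A. g u * Poly_Mapping.lookup u x)"
  define S where "S = {(a, g). a \<in> ?L (sum g A) \<and> (\<forall>x. ?c g x \<le> Poly_Mapping.lookup a x)}"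
  \<comment> \<open>Comparing \<open>a\<close> and \<open>g\<close> alone would not make
    \<open>a - a0\<close> a multiple of the product with multiplicities \<open>g - g0\<close>;
    comparing the cofactor exponents \<open>a - ?c g\<close> does.\<close>
  define h where "h = (\<lambda>(a, g). case_sum (\<lambda>x. Poly_Mapping.lookup a x - ?c g x) g)"
  obtain T where T: "finite T" "T \<subseteq> S"
      "\<forall>s\<in>S. \<exists>t\<in>T. \<forall>x\<in>UNIV <+> A. h t x \<le> h s x"
    using dickson[of "UNIV <+> A" S h] fin by auto
  \<comment> \<open>For \<open>k \<ge> K\<close> the chosen pair comes from a power at most
    \<open>k\<close>, so at least one generator remains on the way to \<open>Suc k\<close>.\<close>
  define K where "K = Max (insert 0 ((\<lambda>(a, g). sum g A) ` T))"
  have K: "sum g A \<le> K" if "(a, g) \<in> T" for a g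
    unfolding K_def using that T(1) by (intro Max_ge) force+
  have "\<exists>u\<in>A. \<exists>b\<in>?L k. a = u + b" if k: "k \<ge> K" and a: "a \<in> ?L (Suc k)" for k a
  proof -
    obtain g where g: "sum g A = Suc k" "\<And>x. ?c g x \<le> Poly_Mapping.lookup a x"
      using lead_degreesE[OF a j] by metis
    have "(a, g) \<in> S" using g a by (auto simp: S_def)
    then obtain a0 g0 where t: "(a0, g0) \<in> T" "\<forall>x\<in>UNIV <+> A. h (a0, g0) x \<le> h (a, g) x"
      using T(3) by (metis surj_pair)
    have a0: "a0 \<in> ?L (sum g0 A)" "\<And>x. ?c g0 x \<le> Poly_Mapping.lookup a0 x"
      using t(1) T(2) by (auto simp: S_def)
    have le: "Poly_Mapping.lookup a0 x - ?c g0 x \<le> Poly_Mapping.lookup a x - ?c g x" for x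
      using t(2) by (force simp: h_def)
    have gle: "g0 u \<le> g u" if "u \<in> A" for u
      using t(2) that by (force simp: h_def)
    define d where "d = (\<lambda>u. g u - g0 u)"
    have "sum g A = sum g0 A + sum d A"
      unfolding d_def sum.distrib[symmetric] using gle by (intro sum.cong) auto
    moreover have "sum g0 A \<le> k" using K[OF t(1)] k by simp
    ultimately obtain q where q: "sum d A = Suc q" "sum g0 A + q = k"
      using g(1) by (metis add_Suc_right add_left_cancel le_Suc_ex nat.inject add_left_imp_eq)
    have split: "(\<Sum>u\<in>A. g u * Poly_Mapping.lookup u x) = (\<Sum>u\<in>A. g0 u * Poly_Mapping.lookup u x) + (\<Sum>u\<in>A. d u * Poly_Mapping.lookup u x)" for x
      unfolding d_def sum.distrib[symmetric] using gle
      by (intro sum.cong) (auto simp flip: add_mult_distrib)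
    \<comment> \<open>The subtractions in \<open>le\<close> are not truncated, because both pairs
      lie in \<open>S\<close>.\<close>
    have dle: "Poly_Mapping.lookup a0 x + (\<Sum>u\<in>A. d u * Poly_Mapping.lookup u x) \<le> Poly_Mapping.lookup a x" for x
      using le[of x] g(2)[of x] a0(2)[of x] split[of x] by linarith
    have "(\<Sum>u\<in>A. d u * Poly_Mapping.lookup u x) \<le> Poly_Mapping.lookup (a - a0) x" for x
      using dle[of x] by (simp add: lookup_minus)
    then have "a - a0 \<in> pow_exps A (Suc q)"
      unfolding pow_exps_def using q(1) by blast
    then obtain u e where u: "u \<in> A" "a - a0 = u + e" "e \<in> pow_exps A q"
      using pow_exps_SucE[OF fin] by metis
    have "a0 + (a - a0) = a" using dle by (intro poly_mapping_le_add_diff) (meson add_leE)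
    \<comment> \<open>The generator \<open>u\<close> is set aside; the other \<open>q\<close>
      factors in \<open>e\<close> lift \<open>a0\<close> to the power \<open>k\<close>.\<close>
    then have "a = u + (e + a0)" using u(2) by (simp add: ac_simps)
    moreover have "e + a0 \<in> ?L k" using lead_degrees_add[OF a0(1) u(3)] q(2) by simp
    ultimately show ?thesis using u(1) by blast
  qed
  then show ?thesis unfolding eventually_sequentially by blast
qed

text \<open>A homogeneous cycle over \<open>I^(k+1)\<close> is reduced to zero by cancelling its leading term against
  a monomial multiple of a cycle over \<open>I^k\<close>; the multiple is a boundary if that cycle is one.\<close>

lemma hom_cycles_boundaries:
  assumes lead: "\<And>j a. j < rk F p \<Longrightarrow> a \<in> lead_degrees F (ideal_pow I (Suc k)) p j \<Longrightarrow>
      \<exists>u\<in>A. \<exists>b\<in>lead_degrees F (ideal_pow I k) p j. a = u + b"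
    and bound: "\<And>u b. u \<in> A \<Longrightarrow> a = u + b \<Longrightarrow>
      hom_cycles F (ideal_pow I k) p b \<subseteq> boundaries F (ideal_pow I k) p"
  shows "hom_cycles F (ideal_pow I (Suc k)) p a \<subseteq> boundaries F (ideal_pow I (Suc k)) p"
proof
  let ?J = "ideal_pow I k" and ?J' = "ideal_pow I (Suc k)"
  note J' = is_ideal_ideal_pow[of I "Suc k"]
  \<comment> \<open>Induction on a bound \<open>N\<close> for the positions of nonzero entries. The
    degree \<open>a\<close> stays fixed, so \<open>bound\<close> applies at every stage.\<close>
  have red: "z \<in> boundaries F ?J' p"
    if "z \<in> hom_cycles F ?J' p a" "\<forall>l\<ge>N. z l = 0" for N z
    using that
  proof (induction N arbitrary: z)
    case 0
    then have "z = (\<lambda>_. 0)" by auto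
    then show ?case using zero_boundaries[OF J'] by metis
  next
    case (Suc N)
    show ?case
    proof (cases "z N = 0")
      case True
      then show ?thesis using Suc by (metis Suc_leI le_neq_implies_less)
    next
      case False
      have N: "N < rk F p"
        using False Suc.prems(1)
        by (intro ccontr[of "N < rk F p"]) (auto simp: hom_cycles_def cycles_def tensor_def not_less)
      have "a \<in> lead_degrees F ?J' p N"
        using Suc.prems False by (auto simp: lead_degrees_def)
      then obtain u b where u: "u \<in> A" "b \<in> lead_degrees F ?J p N" "a = u + b"
        using lead[OF N] by blast
      obtain v where v: "v \<in> hom_cycles F ?J p b" "v N \<noteq> 0" "\<forall>l>N. v l = 0"
        using u(2) by (auto simp: lead_degrees_def)
      define w where "w = (\<lambda>j. monomial u * v j)"
      have mult: "monomial u * f \<in> ?J'" if "f \<in> ?J" for f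
        using ideal_mult_base[OF monomial_mem[OF u(1)] that] by simp
      have w: "w \<in> hom_cycles F ?J' p a" "w \<in> boundaries F ?J' p"
        unfolding w_def u(3) using hom_cycles_monomial[OF mult v(1)]
          boundaries_scale[OF mult] bound[OF u(1,3)] v(1) by blast+
      have "z N \<in> homogeneous (shift F p N) a" "w N \<in> homogeneous (shift F p N) a"
        using Suc.prems(1) w(1) N by (auto simp: hom_cycles_def degree_part_def)
      moreover have "w N \<noteq> 0" using v(2) by (simp add: w_def monomial_times_eq_0_iff)
      ultimately obtain c where c: "z N = Poly_Mapping.single 0 c * w N"
        using homogeneous_proportional by blast
      let ?r = "\<lambda>j. z j - Poly_Mapping.single 0 c * w j"
      have "?r \<in> hom_cycles F ?J' p a"
        by (intro hom_cycles_diff hom_cycles_scalar J' Suc.prems(1) w(1))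
      moreover have "?r l = 0" if "N \<le> l" for l
        using c Suc.prems(2) v(3) that by (cases "l = N") (simp_all add: w_def)
      ultimately have r: "?r \<in> boundaries F ?J' p" by (intro Suc.IH) blast+
      \<comment> \<open>The sign lets \<open>z\<close> be written as a difference of two
        boundaries.\<close>
      have "(\<lambda>j. (- Poly_Mapping.single 0 c) * w j) \<in> boundaries F ?J' p"
        by (rule boundaries_scale[OF is_idealD(3)[OF J'] w(2)])
      from boundaries_diff[OF J' r this] show ?thesis by simp
    qed
  qed
  fix z assume z: "z \<in> hom_cycles F ?J' p a"
  then show "z \<in> boundaries F ?J' p"
    by (intro red[of z "rk F p"]) (auto simp: hom_cycles_def cycles_def tensor_def)
qed

end

section \<open>Passage to homological shift ideals\<close>

theorem theorem1p2:
  fixes I :: "('n::finite, 'k::field) mpoly set" and i :: nat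
  assumes "monomial_ideal I"
  shows "\<forall>\<^sub>F k in sequentially. HS i (ideal_pow I (Suc k)) \<subseteq> ideal_mult I (HS i (ideal_pow I k))"
proof -
  obtain A where "finitely_generated_exps I A"
    using monomial_ideal_finitely_generated[OF assms] by blast
  then interpret finitely_generated_exps I A .
  let ?F = "residue_field_resolution :: ('n, 'k) augmented_complex"
  \<comment> \<open>The rank is finite, so one bound on \<open>k\<close> serves all leading
    indices.\<close>
  have "\<forall>\<^sub>F k in sequentially. \<forall>j\<in>{..<rk ?F i}. \<forall>a \<in> lead_degrees ?F (ideal_pow I (Suc k)) i j.
      \<exists>u\<in>A. \<exists>b \<in> lead_degrees ?F (ideal_pow I k) i j. a = u + b"
    by (intro eventually_ball_finite ballI lead_degrees_eventually) auto
  then show ?thesis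
  proof (rule eventually_mono)
    fix k
    assume lead: "\<forall>j\<in>{..<rk ?F i}. \<forall>a \<in> lead_degrees ?F (ideal_pow I (Suc k)) i j.
      \<exists>u\<in>A. \<exists>b \<in> lead_degrees ?F (ideal_pow I k) i j. a = u + b"
    have "monomial a \<in> ideal_mult I (HS i (ideal_pow I k))"
      if "Tor_component i (ideal_pow I (Suc k)) a \<noteq> {Tor_zero i (ideal_pow I (Suc k))}" for a
    proof -
      have "\<not> hom_cycles ?F (ideal_pow I (Suc k)) i a \<subseteq> boundaries ?F (ideal_pow I (Suc k)) i"
        using that by (simp add: Tor_component_nonzero_iff is_ideal_ideal_pow del: ideal_pow.simps)
      \<comment> \<open>Contrapositive of the reduction: a cycle of degree \<open>a\<close> that is
        not a boundary forces one of some degree \<open>b\<close> with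
        \<open>a = u + b\<close>.\<close>
      then obtain u b where u: "u \<in> A" "a = u + b"
          "\<not> hom_cycles ?F (ideal_pow I k) i b \<subseteq> boundaries ?F (ideal_pow I k) i"
        using hom_cycles_boundaries[of ?F i k a] lead by (metis lessThan_iff)
      have "Tor_component i (ideal_pow I k) b \<noteq> {Tor_zero i (ideal_pow I k)}"
        using u(3) by (simp add: Tor_component_nonzero_iff is_ideal_ideal_pow)
      then have "monomial b \<in> HS i (ideal_pow I k)"
        unfolding HS_def by (intro ideal_gen_base CollectI exI[of _ b] conjI refl)
      then show ?thesis
        unfolding u(2) monomial_add by (rule ideal_mult_base[OF monomial_mem[OF u(1)]])
    qed
    then show "HS i (ideal_pow I (Suc k)) \<subseteq> ideal_mult I (HS i (ideal_pow I k))"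
      unfolding HS_def[of i "ideal_pow I (Suc k)"]
      by (intro ideal_gen_minimal is_ideal_ideal_mult subsetI) (elim CollectE exE conjE, simp only:)
  qed
qed

end
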